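(* For every fixed integer $k\ge 2$, \[ \lim_{n\rightarrow\infty} m(n,k)\cdot\frac{k(k-1)}{n(n-1)}=1 . \]
   Context: A hypergraph is an ordered pair $(X,H)$ such that $X$ is a set and $H$ is a family of subsets of $X$; elements of $X$ are its vertices and members of $H$ are its edges (edges may have arbitrary sizes). For any two distinct vertices $u,v$ of a hypergraph $(X,H)$, the line $\overline{uv}$ is the set $\{u,v\}\cup\{p\in X:\ \exists\, T\in H \text{ with } \{u,v,p\}\subseteq T\}$. The lines of the hypergraph are all the sets $\overline{uv}$ with $u,v$ distinct vertices; the number of lines is the number of distinct such sets. For integers $n,k$, $m(n,k)$ denotes the smallest number of (distinct) lines in a hypergraph on $n$ vertices where every line consists of at most $k$ vertices. *)

theory Defs
  imports Complex_Main
begin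

definition hypergraph :: "'a set \<Rightarrow> 'a set set \<Rightarrow> bool" where
  "hypergraph X H \<longleftrightarrow> H \<subseteq> Pow X"

definition line :: "'a set \<Rightarrow> 'a set set \<Rightarrow> 'a \<Rightarrow> 'a \<Rightarrow> 'a set" where
  "line X H u v = {u, v} \<union> {p \<in> X. \<exists>T\<in>H. {u, v, p} \<subseteq> T}"

definition lines :: "'a set \<Rightarrow> 'a set set \<Rightarrow> 'a set set" where
  "lines X H = {line X H u v | u v. u \<in> X \<and> v \<in> X \<and> u \<noteq> v}"

(* Vertices are taken to be natural numbers; up to relabelling this covers every
   hypergraph with finitely many vertices.  A minimum exists whenever k >= 2 (take H = {}). *)
definition min_lines :: "nat \<Rightarrow> nat \<Rightarrow> nat" where
  "min_lines n k = (LEAST l. \<exists>(X :: nat set) H.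
     hypergraph X H \<and> finite X \<and> card X = n \<and>
     (\<forall>L\<in>lines X H. card L \<le> k) \<and> card (lines X H) = l)"

end

theory Submission
  imports Defs "HOL-Real_Asymp.Real_Asymp" "HOL-Number_Theory.Cong"
begin

text \<open>
  Every pair of vertices lies in its own line and a line holds at most \<open>k (k - 1)\<close> ordered pairs,
  which gives the lower bound. For the upper bound take the edges to be the blocks of a linear
  space with block sizes at most \<open>k\<close>: the lines are then blocks. Such a space on \<open>n\<close> points
  with few blocks is built recursively. Choose \<open>m \<le> n div k\<close> with \<open>m\<close> congruent to \<open>1\<close> modulo
  \<open>k!\<close>, so that \<open>n - k m\<close> is bounded. As all differences of elements of \<open>{0, ..., k - 1}\<close> are
  units modulo \<open>m\<close>, the \<open>m\<^sup>2\<close> graphs of the maps \<open>i \<mapsto> a i + b mod m\<close> form a transversal design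
  on \<open>k\<close> groups of size \<open>m\<close>; fill each group recursively and join the remaining points to all
  others by blocks of size two. The count \<open>b(n) \<le> m\<^sup>2 + k b(m) + O(n)\<close> solves to
  \<open>n\<^sup>2 / (k (k - 1)) + O(n log n)\<close>.
\<close>

section \<open>Linear spaces: relabelling and adding points\<close>

definition linear_space :: "nat \<Rightarrow> 'a set \<Rightarrow> 'a set set \<Rightarrow> bool" where
  "linear_space k X B \<longleftrightarrow> (\<forall>T\<in>B. T \<subseteq> X \<and> card T \<le> k) \<and>
     (\<forall>u\<in>X. \<forall>v\<in>X. u \<noteq> v \<longrightarrow> (\<exists>!T. T \<in> B \<and> u \<in> T \<and> v \<in> T))"

lemma linear_space_finite: "linear_space k X B \<Longrightarrow> finite X \<Longrightarrow> finite B"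
  unfolding linear_space_def by (rule finite_subset[of _ "Pow X"]) auto

lemma linear_space_image:
  assumes B: "linear_space k X B" and f: "inj_on f X"
  shows "linear_space k (f ` X) ((`) f ` B)"
  unfolding linear_space_def
proof (intro conjI ballI impI)
  have sub: "\<And>T. T \<in> B \<Longrightarrow> T \<subseteq> X" and card: "\<And>T. T \<in> B \<Longrightarrow> card T \<le> k"
    using B unfolding linear_space_def by auto
  fix S assume "S \<in> (`) f ` B"
  then obtain T where T: "T \<in> B" "S = f ` T" by auto
  show "S \<subseteq> f ` X" using T sub by auto
  show "card S \<le> k" using T card[of T] card_image[of f T] inj_on_subset[OF f sub[of T]] by auto
next
  have sub: "\<And>T. T \<in> B \<Longrightarrow> T \<subseteq> X"
    using B unfolding linear_space_def by auto
  fix u v assume "u \<in> f ` X" "v \<in> f ` X" "u \<noteq> v"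
  then obtain x y where xy: "x \<in> X" "y \<in> X" "u = f x" "v = f y" "x \<noteq> y" by auto
  have mem: "f z \<in> f ` T \<longleftrightarrow> z \<in> T" if "z \<in> X" "T \<in> B" for z T
    using inj_on_image_mem_iff[OF f that(1) sub[OF that(2)]] .
  obtain T where T: "T \<in> B" "x \<in> T" "y \<in> T"
    and uniq: "\<And>S. S \<in> B \<Longrightarrow> x \<in> S \<Longrightarrow> y \<in> S \<Longrightarrow> S = T"
    using B xy unfolding linear_space_def by metis
  show "\<exists>!S. S \<in> (`) f ` B \<and> u \<in> S \<and> v \<in> S"
  proof (rule ex1I[of _ "f ` T"])
    show "f ` T \<in> (`) f ` B \<and> u \<in> f ` T \<and> v \<in> f ` T" using T xy by simp
    fix S assume S: "S \<in> (`) f ` B \<and> u \<in> S \<and> v \<in> S"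
    then obtain R where R: "R \<in> B" "S = f ` R" by auto
    then have "x \<in> R" "y \<in> R" using S mem xy by simp_all
    then show "S = f ` T" using uniq R by simp
  qed
qed

text \<open>Only the number of points matters. The recursion uses this to move between
  \<open>{..<n}\<close>, residues modulo \<open>m\<close> as integers, and the product set carrying
  the transversal design.\<close>

lemma linear_space_transfer:
  fixes X :: "'a set" and Y :: "'b set"
  assumes "linear_space k X B" "finite X" "finite Y" "card X = card Y"
  obtains C where "linear_space k Y C" "card C \<le> card B"
proof -
  obtain f where f: "bij_betw f X Y"
    using assms(2-4) finite_same_card_bij by blast
  have "linear_space k Y ((`) f ` B)"
    using linear_space_image[OF assms(1)] f unfolding bij_betw_def by auto
  moreover have "card ((`) f ` B) \<le> card B"
    using linear_space_finite[OF assms(1,2)] by (rule card_image_le)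
  ultimately show ?thesis using that by blast
qed

text \<open>Every pair that meets \<open>Y - X\<close> becomes a block of its own, which is a legal
  block since \<open>k \<ge> 2\<close>. The crude count is affordable because the recursion adds
  only boundedly many points.\<close>

lemma linear_space_extend:
  assumes B: "linear_space k X B" and "finite Y" "X \<subseteq> Y" "k \<ge> 2"
  obtains C where "linear_space k Y C" "card C \<le> card B + card (Y - X) * card Y"
proof -
  \<comment> \<open>The case \<open>u = v\<close> yields singletons; they contain no two distinct
    points, so uniqueness of blocks is unaffected.\<close>
  define E where "E = (\<lambda>(u, v). {u, v}) ` ((Y - X) \<times> Y)"
  have finB: "finite B"
    using linear_space_finite[OF B] assms finite_subset by blast
  have finE: "finite E" unfolding E_def using assms by auto
  have cE: "card E \<le> card (Y - X) * card Y"
    unfolding E_def card_cartesian_product[symmetric] using assms by (intro card_image_le) auto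
  have Bsub: "T \<in> B \<Longrightarrow> T \<subseteq> X" and Bcard: "T \<in> B \<Longrightarrow> card T \<le> k" for T
    using B unfolding linear_space_def by auto
  have EI: "{u, v} \<in> E" if "u \<in> Y" "v \<in> Y" "u \<notin> X \<or> v \<notin> X" for u v
  proof (cases "u \<in> X")
    case True
    then have "(\<lambda>(u, v). {u, v}) (v, u) \<in> E" unfolding E_def using that by (intro imageI) auto
    then show ?thesis by (simp add: insert_commute)
  next
    case False
    then have "(\<lambda>(u, v). {u, v}) (u, v) \<in> E" unfolding E_def using that by (intro imageI) auto
    then show ?thesis by simp
  qed
  have "linear_space k Y (B \<union> E)"
    unfolding linear_space_def
  proof (intro conjI ballI impI)
    fix T assume T: "T \<in> B \<union> E"
    show "T \<subseteq> Y" using T Bsub assms(3) unfolding E_def by auto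
    show "card T \<le> k"
      using T Bcard \<open>k \<ge> 2\<close> card_insert_le_m1 unfolding E_def by (auto simp: card_insert_if)
  next
    fix u v assume uv: "u \<in> Y" "v \<in> Y" "u \<noteq> v"
    show "\<exists>!T. T \<in> B \<union> E \<and> u \<in> T \<and> v \<in> T"
    proof (cases "u \<in> X \<and> v \<in> X")
      case True
      then have "\<exists>!T. T \<in> B \<and> u \<in> T \<and> v \<in> T" using B uv unfolding linear_space_def by auto
      moreover have "T \<notin> E" if "u \<in> T" "v \<in> T" for T
        using that True uv unfolding E_def by auto
      ultimately show ?thesis by (metis UnE UnI1)
    next
      case False
      show ?thesis
      proof (rule ex1I[of _ "{u, v}"])
        show "{u, v} \<in> B \<union> E \<and> u \<in> {u, v} \<and> v \<in> {u, v}" using EI uv False by auto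
        fix T assume T: "T \<in> B \<union> E \<and> u \<in> T \<and> v \<in> T"
        then have "T \<in> E" using Bsub False by auto
        then show "T = {u, v}" using T uv unfolding E_def by auto
      qed
    qed
  qed
  moreover have "card (B \<union> E) \<le> card B + card (Y - X) * card Y"
    using card_Un_le[of B E] cE by linarith
  ultimately show ?thesis using that by blast
qed

section \<open>Transversal designs from affine maps modulo \<open>m\<close>\<close>

text \<open>The slope has to be \<open>(x - y) / (i - j)\<close>, and this quotient exists modulo
  \<open>m\<close> because \<open>i - j\<close> is a unit; the intercept is then forced.\<close>

lemma affine_interpolation_mod:
  fixes m i j x y :: int
  assumes m: "m > 0" and cop: "coprime (i - j) m" and "x \<in> {0..<m}" "y \<in> {0..<m}"
  shows "\<exists>!(a, b). a \<in> {0..<m} \<and> b \<in> {0..<m} \<and> (a * i + b) mod m = x \<and> (a * j + b) mod m = y"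
proof -
  obtain c where c: "[(i - j) * c = 1] (mod m)"
    using cong_solve_coprime_int[OF cop] by blast
  define a where "a = (c * (x - y)) mod m"
  define b where "b = (x - a * i) mod m"
  have 1: "(a * i + b) mod m = x"
    using assms(3) unfolding b_def by (simp add: mod_simps)
  have "[a = c * (x - y)] (mod m)" unfolding a_def by (simp add: cong_def)
  then have "[a * (i - j) = (c * (x - y)) * (i - j)] (mod m)" by (rule cong_scalar_right)
  also have "(c * (x - y)) * (i - j) = ((i - j) * c) * (x - y)" by (simp add: mult_ac)
  also have "[((i - j) * c) * (x - y) = 1 * (x - y)] (mod m)"
    using c by (rule cong_scalar_right)
  \<comment> \<open>Lowering the value at \<open>i\<close> by slope times \<open>i - j\<close> gives
    the value at \<open>j\<close>.\<close>
  finally have "[(a * i + b) - a * (i - j) = x - (x - y)] (mod m)"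
    using 1 assms(3) by (intro cong_diff) (auto simp: cong_def)
  moreover have "(a * i + b) - a * (i - j) = a * j + b" "x - (x - y) = y"
    by (simp_all add: algebra_simps)
  ultimately have "[a * j + b = y] (mod m)" by (simp only:)
  then have 2: "(a * j + b) mod m = y"
    using assms(4) unfolding cong_def by simp
  have uniq: "a' = a \<and> b' = b" if "a' \<in> {0..<m}" "b' \<in> {0..<m}"
     "(a' * i + b') mod m = x" "(a' * j + b') mod m = y" for a' b'
  proof -
    have ci: "[a' * i + b' = a * i + b] (mod m)" and cj: "[a' * j + b' = a * j + b] (mod m)"
      using 1 2 that by (auto simp: cong_def)
    \<comment> \<open>Subtracting the two congruences eliminates the intercepts, and the unit
      \<open>i - j\<close> can then be cancelled to compare the slopes.\<close>
    have "[(a' * i + b') - (a' * j + b') = (a * i + b) - (a * j + b)] (mod m)"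
      using ci cj by (rule cong_diff)
    then have "[a' * (i - j) = a * (i - j)] (mod m)" by (simp add: algebra_simps)
    then have "[a' = a] (mod m)" using cong_mult_rcancel[OF cop] by blast
    then have a: "a' = a" using that(1) m by (simp add: cong_def a_def)
    have "[b' = b] (mod m)" using ci unfolding a by (simp add: cong_add_lcancel)
    then show ?thesis using a that(2) m by (simp add: cong_def b_def)
  qed
  have rng: "a \<in> {0..<m}" "b \<in> {0..<m}" unfolding a_def b_def using m by auto
  show ?thesis
  proof (rule ex1I[of _ "(a, b)"])
    show "case (a, b) of (a, b) \<Rightarrow> a \<in> {0..<m} \<and> b \<in> {0..<m} \<and>
        (a * i + b) mod m = x \<and> (a * j + b) mod m = y"
      using 1 2 rng by simp
  qed (use uniq in auto)
qed

text \<open>Points in different groups lie on exactly one graph, by interpolation, and in no block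
  inside a group. Points in the same group lie on no common graph, since a graph takes one value at
  each index, so the copy of \<open>B\<close> on that group supplies their block.\<close>

lemma linear_space_transversal_design:
  fixes m :: int
  assumes B: "linear_space k {0..<m} B" and m: "m > 0"
    and cop: "\<And>i j. i < k \<Longrightarrow> j < k \<Longrightarrow> i \<noteq> j \<Longrightarrow> coprime (int i - int j) m"
  obtains C where "linear_space k ({..<k} \<times> {0..<m}) C" "card C \<le> nat m ^ 2 + k * card B"
proof -
  define G where "G = (\<lambda>(a, b). (\<lambda>i. (i, (a * int i + b) mod m)) ` {..<k})"
  define F where "F = (\<lambda>(i::nat, T). {i} \<times> T) ` ({..<k} \<times> B)"
  define D where "D = G ` ({0..<m} \<times> {0..<m})"
  have finB: "finite B" using linear_space_finite[OF B] by simp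
  have "card F \<le> k * card B" unfolding F_def
    using card_image_le[of "{..<k} \<times> B"] finB by (simp add: card_cartesian_product)
  moreover have "card D \<le> nat m ^ 2" unfolding D_def
    using card_image_le[of "{0..<m} \<times> {0..<m}" G]
    by (simp add: card_cartesian_product power2_eq_square)
  ultimately have card: "card (D \<union> F) \<le> nat m ^ 2 + k * card B"
    using card_Un_le[of D F] by linarith
  have memG: "(i, x) \<in> G p \<longleftrightarrow> i < k \<and> (fst p * int i + snd p) mod m = x" for i x p
    unfolding G_def by (auto split: prod.splits)
  have "linear_space k ({..<k} \<times> {0..<m}) (D \<union> F)"
    unfolding linear_space_def
  proof (intro conjI ballI impI)
    fix T assume T: "T \<in> D \<union> F"
    show "T \<subseteq> {..<k} \<times> {0..<m}"
    proof (cases "T \<in> D")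
      case True
      then show ?thesis using m unfolding D_def G_def by auto
    next
      case False
      then show ?thesis using T B unfolding F_def linear_space_def by blast
    qed
    have "card (G p) \<le> k" for p
      unfolding G_def using card_image_le[of "{..<k}"] by (auto split: prod.splits)
    moreover have "card ({i} \<times> T) \<le> k" if "T \<in> B" for i :: nat and T
      using B that unfolding linear_space_def by (simp add: card_cartesian_product)
    ultimately show "card T \<le> k"
      using T unfolding D_def F_def by auto
  next
    fix u v assume uv: "u \<in> {..<k} \<times> {0..<m}" "v \<in> {..<k} \<times> {0..<m}" "u \<noteq> v"
    obtain i x j y where u: "u = (i, x)" and v: "v = (j, y)" by fastforce
    have ix: "i < k" "j < k" "x \<in> {0..<m}" "y \<in> {0..<m}" using uv u v by auto
    show "\<exists>!T. T \<in> D \<union> F \<and> u \<in> T \<and> v \<in> T"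
    proof (cases "i = j")
      case True
      then have "x \<noteq> y" using uv u v by auto
      then obtain T where T: "T \<in> B" "x \<in> T" "y \<in> T"
        and uniq: "\<And>S. S \<in> B \<Longrightarrow> x \<in> S \<Longrightarrow> y \<in> S \<Longrightarrow> S = T"
        using B ix unfolding linear_space_def by metis
      show ?thesis
      proof (rule ex1I[of _ "{i} \<times> T"])
        show "{i} \<times> T \<in> D \<union> F \<and> u \<in> {i} \<times> T \<and> v \<in> {i} \<times> T"
          using T ix u v True unfolding F_def by auto
        fix S assume S: "S \<in> D \<union> F \<and> u \<in> S \<and> v \<in> S"
        then have "S \<in> F"
          using \<open>x \<noteq> y\<close> True u v memG unfolding D_def by auto
        then show "S = {i} \<times> T" using S uniq u v unfolding F_def by auto
      qed
    next
      case False
      have "\<exists>!(a, b). a \<in> {0..<m} \<and> b \<in> {0..<m} \<and>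
          (a * int i + b) mod m = x \<and> (a * int j + b) mod m = y"
        using affine_interpolation_mod[OF m cop[OF ix(1,2) False] ix(3,4)] .
      \<comment> \<open>Uniqueness is obtained for the parameter pair \<open>p\<close>. It passes to
        blocks because any graph \<open>G q\<close> through \<open>u\<close> and \<open>v\<close>
        has \<open>q = p\<close>.\<close>
      then have ex: "\<exists>!p. p \<in> {0..<m} \<times> {0..<m} \<and> u \<in> G p \<and> v \<in> G p"
        using ix unfolding u v memG by (simp add: case_prod_unfold mem_Times_iff conj_assoc)
      then obtain p where p: "p \<in> {0..<m} \<times> {0..<m}" "u \<in> G p" "v \<in> G p" by blast
      show ?thesis
      proof (rule ex1I[of _ "G p"])
        show "G p \<in> D \<union> F \<and> u \<in> G p \<and> v \<in> G p" using p unfolding D_def by blast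
        fix S assume S: "S \<in> D \<union> F \<and> u \<in> S \<and> v \<in> S"
        then have "S \<notin> F" using False u v unfolding F_def by auto
        then obtain q where q: "q \<in> {0..<m} \<times> {0..<m}" "S = G q"
          using S unfolding D_def by blast
        then have "q = p" using ex p S by blast
        then show "S = G p" using q by simp
      qed
    qed
  qed
  then show ?thesis using that card by blast
qed

section \<open>The recursive construction and its block count\<close>

text \<open>The three terms count the graphs, the blocks filling the \<open>k\<close> groups, and
  the pairs through the \<open>n - k * m\<close> leftover points.\<close>

lemma linear_space_recursion:
  assumes B: "linear_space k {..<m} B" and "k \<ge> 2" "m > 0" "[m = 1] (mod fact k)" "k * m \<le> n"
  obtains C where "linear_space k {..<n} C" "card C \<le> m ^ 2 + k * card B + (n - k * m) * n"
proof -
  obtain B1 where B1: "linear_space k {0..<int m} B1" "card B1 \<le> card B"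
    using linear_space_transfer[OF B, of "{0..<int m}"] by auto
  have "coprime m (fact k)"
    using cong_imp_coprime[OF cong_sym[OF assms(4)]] by simp
  have "coprime (int i - int j) (int m)" if "i < k" "j < k" "i \<noteq> j" for i j
  proof -
    \<comment> \<open>The absolute difference lies between 1 and \<open>k - 1\<close>, so it is a
      factor of \<open>fact k\<close>, which is coprime to \<open>m\<close>.\<close>
    have "nat \<bar>int i - int j\<bar> dvd fact k" using that by (intro dvd_fact) auto
    then have "coprime (nat \<bar>int i - int j\<bar>) m"
      using \<open>coprime m (fact k)\<close> by (metis coprime_commute coprime_divisors dvd_refl)
    then have "coprime (int (nat \<bar>int i - int j\<bar>)) (int m)" by (simp only: coprime_int_iff)
    then show ?thesis by simp
  qed
  then obtain C1 where C1: "linear_space k ({..<k} \<times> {0..<int m}) C1"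
      "card C1 \<le> m ^ 2 + k * card B1"
    using linear_space_transversal_design[OF B1(1)] assms(3) by auto
  obtain C2 where C2: "linear_space k {..<k * m} C2" "card C2 \<le> card C1"
    using linear_space_transfer[OF C1(1), of "{..<k * m}"] by (auto simp: card_cartesian_product)
  have "{..<n} - {..<k * m} = {k * m..<n}" by auto
  then obtain C where C: "linear_space k {..<n} C" "card C \<le> card C2 + (n - k * m) * n"
    using linear_space_extend[OF C2(1), of "{..<n}"] assms by auto
  have "k * card B1 \<le> k * card B" using B1(2) by simp
  then have "card C \<le> m ^ 2 + k * card B + (n - k * m) * n"
    using C C2 C1 by linarith
  then show ?thesis using that C by blast
qed

text \<open>Rounding \<open>n\<close> down to a multiple of \<open>k\<close> loses less than
  \<open>k\<close>. Lowering the quotient to the nearest number congruent to 1 loses less than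
  \<open>N\<close>, hence less than \<open>k * N\<close> after multiplication by
  \<open>k\<close>.\<close>

lemma cong_one_near_quotient:
  assumes "(k::nat) \<le> n" "k > 0" "N > 0"
  obtains m where "m > 0" "[m = 1] (mod N)" "k * m \<le> n" "n - k * m \<le> k * (N + 1)"
proof
  \<comment> \<open>This is the largest \<open>t\<close> with
    \<open>1 + N * t \<le> n div k\<close>. The truncated subtraction is exact because
    \<open>n div k \<ge> 1\<close>.\<close>
  define t where "t = (n div k - 1) div N"
  have q: "n div k \<ge> 1" using assms by (simp add: Suc_le_eq div_greater_zero_iff)
  have t1: "N * t \<le> n div k - 1" unfolding t_def by (rule times_div_less_eq_dividend)
  have t2: "n div k - 1 < N * t + N"
    unfolding t_def using dividend_less_times_div[OF assms(3), of "n div k - 1"] by linarith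
  show "1 + N * t > 0" by simp
  show "[1 + N * t = 1] (mod N)" by (simp only: cong_def mod_mult_self2)
  have "k * (1 + N * t) \<le> k * (n div k)" using t1 q by (intro mult_le_mono) auto
  then show "k * (1 + N * t) \<le> n" using times_div_less_eq_dividend[of k n] by linarith
  have "n < k * (n div k + 1)" using dividend_less_times_div[OF assms(2), of n] by (simp only: distrib_left)
  also have "\<dots> \<le> k * (1 + N * t + (N + 1))" using t2 by (intro mult_le_mono) auto
  finally show "n - k * (1 + N * t) \<le> k * (N + 1)" by (simp add: distrib_left)
qed

text \<open>The quadratic term reproduces itself under the recursion. Since \<open>m\<close> is at
  most half of \<open>n\<close>, the logarithm drops by at least one at each level, which pays for
  the linear cost of the leftover points.\<close>

lemma linear_space_few_blocks:
  assumes "k \<ge> 2" "n \<ge> 1"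
  shows "\<exists>B. linear_space k {..<n} B \<and>
    real (card B) \<le> real n ^ 2 / (real k * (real k - 1)) +
      real (k * (fact k + 1)) * real n * (log 2 (real n) + 1)"
  using assms(2)
proof (induction n rule: less_induct)
  case (less n)
  define D where "D = k * (fact k + 1 :: nat)"
  define \<alpha> where "\<alpha> = 1 / (real k * (real k - 1))"
  \<comment> \<open>The second equation is the fixed-point condition for the leading coefficient in
    \<open>m ^ 2 + k * b(m)\<close> with \<open>n\<close> close to \<open>k * m\<close>.\<close>
  have \<alpha>: "\<alpha> \<ge> 0" "1 + real k * \<alpha> = real k ^ 2 * \<alpha>"
    unfolding \<alpha>_def using assms(1) by (auto simp: field_simps power2_eq_square)
  have "\<exists>B. linear_space k {..<n} B \<and>
    real (card B) \<le> \<alpha> * real n ^ 2 + real D * real n * (log 2 (real n) + 1)"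
  proof (cases "n < k")
    case True
    have "linear_space k ({}::nat set) {}" unfolding linear_space_def by auto
    from linear_space_extend[OF this, of "{..<n}"] obtain B
      where B: "linear_space k {..<n} B" "card B \<le> n * n" using assms(1) by auto
    \<comment> \<open>Below \<open>k\<close> all pairs serve as blocks, and
      \<open>n < k \<le> D\<close> puts their number under the linear term; the summand 1 beside the
      logarithm covers this even at \<open>n = 1\<close>.\<close>
    have "n \<le> D" using True unfolding D_def by (simp add: trans_le_add2)
    then have "real n * real n \<le> real D * real n" by (intro mult_right_mono) auto
    also have "\<dots> = real D * real n * 1" by simp
    also have "\<dots> \<le> real D * real n * (log 2 (real n) + 1)"
      using less.prems by (intro mult_left_mono) auto
    finally have "real (n * n) \<le> real D * real n * (log 2 (real n) + 1)" by simp
    moreover have "real (card B) \<le> real (n * n)" using B(2) by (simp only: of_nat_le_iff)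
    moreover have "\<alpha> * real n ^ 2 \<ge> 0" using \<alpha> by simp
    ultimately show ?thesis using B(1) by (intro exI[of _ B]) linarith
  next
    case False
    obtain m where m: "m > 0" "[m = 1] (mod fact k)" "k * m \<le> n" "n - k * m \<le> D"
      using cong_one_near_quotient[of k n "fact k"] False assms(1) unfolding D_def by auto
    have "2 * m \<le> k * m" using assms(1) by (rule mult_le_mono1)
    then have mn: "2 * m \<le> n" using m by linarith
    obtain B where B: "linear_space k {..<m} B"
      "real (card B) \<le> \<alpha> * real m ^ 2 + real D * real m * (log 2 (real m) + 1)"
      using less.IH[of m] m mn unfolding \<alpha>_def D_def by auto
    obtain C where C: "linear_space k {..<n} C"
      "card C \<le> m ^ 2 + k * card B + (n - k * m) * n"
      using linear_space_recursion[OF B(1) assms(1) m(1-3)] .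
    have km: "real k * real m \<le> real n" using m(3) by (metis of_nat_le_iff of_nat_mult)
    \<comment> \<open>The halving \<open>2 * m \<le> n\<close> gains one unit of the base-2
      logarithm.\<close>
    have "log 2 (real m) + 1 = log 2 (real (2 * m))"
      using m(1) by (simp add: log_mult)
    also have "\<dots> \<le> log 2 (real n)" using mn m(1) by (subst log_le_cancel_iff) auto
    finally have lg: "log 2 (real m) + 1 \<le> log 2 (real n)" .
    have "card C \<le> m ^ 2 + k * card B + D * n"
      using C(2) mult_le_mono1[OF m(4), of n] by linarith
    then have "real (card C) \<le> real (m ^ 2 + k * card B + D * n)" by (simp only: of_nat_le_iff)
    also have "\<dots> = real m ^ 2 + real k * real (card B) + real D * real n" by simp
    also have "\<dots> \<le> real m ^ 2 +
        real k * (\<alpha> * real m ^ 2 + real D * real m * (log 2 (real m) + 1)) + real D * real n"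
      using B(2) by (intro add_mono mult_left_mono) auto
    also have "\<dots> = (1 + real k * \<alpha>) * real m ^ 2 +
        real D * ((real k * real m) * (log 2 (real m) + 1)) + real D * real n"
      by (simp add: algebra_simps)
    also have "(1 + real k * \<alpha>) * real m ^ 2 = \<alpha> * (real k * real m) ^ 2"
      unfolding \<alpha>(2) by (simp add: power_mult_distrib)
    also have "\<alpha> * (real k * real m) ^ 2 + real D * ((real k * real m) * (log 2 (real m) + 1)) +
        real D * real n \<le> \<alpha> * real n ^ 2 + real D * (real n * log 2 (real n)) + real D * real n"
      using km lg \<alpha>(1) m(1) by (intro add_mono mult_left_mono mult_mono power_mono) auto
    also have "\<dots> = \<alpha> * real n ^ 2 + real D * real n * (log 2 (real n) + 1)"
      by (simp add: algebra_simps)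
    finally show ?thesis using C(1) by blast
  qed
  then show ?case unfolding \<alpha>_def D_def by simp
qed

section \<open>Lines of a linear space and the upper bound\<close>

text \<open>A point shares an edge with \<open>u\<close> and \<open>v\<close> only through the one
  block containing both, so their line is that block.\<close>

lemma lines_linear_space_subset:
  assumes B: "linear_space k X B"
  shows "lines X B \<subseteq> B"
proof
  fix L assume "L \<in> lines X B"
  then obtain u v where uv: "u \<in> X" "v \<in> X" "u \<noteq> v" "L = line X B u v"
    unfolding lines_def by auto
  then obtain T where T: "T \<in> B" "u \<in> T" "v \<in> T"
    and uniq: "\<And>S. S \<in> B \<Longrightarrow> u \<in> S \<Longrightarrow> v \<in> S \<Longrightarrow> S = T"
    using B unfolding linear_space_def by metis
  have "T \<subseteq> X" using B T unfolding linear_space_def by auto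
  moreover have "(\<exists>S\<in>B. {u, v, p} \<subseteq> S) \<longleftrightarrow> p \<in> T" for p
    using T uniq by (metis empty_subsetI insert_subset)
  ultimately have "L = T" unfolding uv(4) line_def using T by auto
  then show "L \<in> B" using T by simp
qed

lemma linear_space_hypergraph: "linear_space k X B \<Longrightarrow> hypergraph X B"
  unfolding linear_space_def hypergraph_def by blast

lemma linear_space_card_lines_le: "linear_space k X B \<Longrightarrow> \<forall>L\<in>lines X B. card L \<le> k"
  using lines_linear_space_subset[of k X B] by (auto simp: linear_space_def)

lemma min_lines_le_card_linear_space:
  assumes B: "linear_space k {..<n} B"
  shows "min_lines n k \<le> card B"
proof -
  have "min_lines n k \<le> card (lines {..<n} B)"
    unfolding min_lines_def
    by (intro Least_le exI[of _ "{..<n}"] exI[of _ B])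
    (use linear_space_hypergraph[OF B] linear_space_card_lines_le[OF B] in simp)
  also have "\<dots> \<le> card B"
    using linear_space_finite[OF B] lines_linear_space_subset[OF B] by (intro card_mono) auto
  finally show ?thesis .
qed

section \<open>The lower bound by counting pairs\<close>

lemma card_off_diagonal:
  assumes "finite X"
  shows "card (X \<times> X - Id) = card X * (card X - 1)"
proof -
  have "X \<times> X - Id = (SIGMA u:X. X - {u})" by auto
  then show ?thesis using assms by (simp add: card_SigmaI)
qed

text \<open>Ordered pairs of distinct points are the off-diagonal part of
  \<open>X \<times> X\<close>. The off-diagonal squares of the lines cover it, and a union bound
  finishes.\<close>

lemma pairs_le_card_lines:
  assumes "finite X" and L: "\<forall>L\<in>lines X H. card L \<le> k"
  shows "card X * (card X - 1) \<le> card (lines X H) * (k * (k - 1))"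
proof -
  have sub: "lines X H \<subseteq> Pow X" unfolding lines_def line_def by auto
  then have fin: "finite (lines X H)" using assms(1) finite_subset by auto
  have "X \<times> X - Id \<subseteq> (\<Union>L\<in>lines X H. L \<times> L - Id)"
  proof
    fix p assume p: "p \<in> X \<times> X - Id"
    obtain u v where uv: "p = (u, v)" by fastforce
    have "line X H u v \<in> lines X H" using p uv unfolding lines_def by auto
    moreover have "p \<in> line X H u v \<times> line X H u v - Id" using p uv unfolding line_def by auto
    ultimately show "p \<in> (\<Union>L\<in>lines X H. L \<times> L - Id)" by blast
  qed
  then have "card (X \<times> X - Id) \<le> card (\<Union>L\<in>lines X H. L \<times> L - Id)"
    using fin sub assms(1) by (intro card_mono finite_UN_I finite_Diff finite_cartesian_product)
      (auto intro: finite_subset)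
  also have "\<dots> \<le> (\<Sum>L\<in>lines X H. card (L \<times> L - Id))" using fin by (rule card_UN_le)
  also have "\<dots> \<le> (\<Sum>L\<in>lines X H. k * (k - 1))"
  proof (rule sum_mono)
    fix M assume M: "M \<in> lines X H"
    then have "finite M" using sub assms(1) by (auto intro: finite_subset)
    then show "card (M \<times> M - Id) \<le> k * (k - 1)"
      using L M by (simp add: card_off_diagonal mult_le_mono diff_le_mono)
  qed
  finally show ?thesis using assms(1) by (simp add: card_off_diagonal)
qed

text \<open>A \<open>LEAST\<close> value has its defining property only once some candidate exists.
  The linear space of all pairs provides one, which is where \<open>k \<ge> 2\<close>
  enters.\<close>

lemma min_lines_attained:
  assumes "k \<ge> 2"
  obtains X :: "nat set" and H where "finite X" "card X = n"
    "\<forall>L\<in>lines X H. card L \<le> k" "card (lines X H) = min_lines n k"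
proof -
  have "linear_space k ({}::nat set) {}" unfolding linear_space_def by auto
  from linear_space_extend[OF this, of "{..<n}"] obtain B where B: "linear_space k {..<n} B"
    using assms by auto
  have "\<exists>(X :: nat set) H. hypergraph X H \<and> finite X \<and> card X = n \<and>
     (\<forall>L\<in>lines X H. card L \<le> k) \<and> card (lines X H) = card (lines {..<n} B)"
    by (intro exI[of _ "{..<n}"] exI[of _ B])
    (use linear_space_hypergraph[OF B] linear_space_card_lines_le[OF B] in simp)
  from LeastI[of "\<lambda>l. \<exists>(X :: nat set) H. hypergraph X H \<and> finite X \<and> card X = n \<and>
     (\<forall>L\<in>lines X H. card L \<le> k) \<and> card (lines X H) = l", OF this]
  show ?thesis using that unfolding min_lines_def by blast
qed

section \<open>The limit by squeezing\<close>

theorem theorem6: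
  fixes k :: nat
  assumes "k \<ge> 2"
  shows "(\<lambda>n. real (min_lines n k) * ((real k * (real k - 1)) / (real n * (real n - 1))))
           \<longlonglongrightarrow> 1"
proof -
  define K where "K = real k * (real k - 1)"
  define D where "D = real (k * (fact k + 1))"
  have K: "K > 0" unfolding K_def using assms by simp
  \<comment> \<open>For \<open>n < 2\<close> the denominator is 0, the quotient defaults to 0 and
    the bound fails, so both bounds are stated from 2 on.\<close>
  have lower: "1 \<le> real (min_lines n k) * (K / (real n * (real n - 1)))" if n: "n \<ge> 2" for n
  proof -
    obtain X :: "nat set" and H where XH: "finite X" "card X = n"
      "\<forall>L\<in>lines X H. card L \<le> k" "card (lines X H) = min_lines n k"
      using min_lines_attained[OF assms] .
    have "n * (n - 1) \<le> min_lines n k * (k * (k - 1))"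
      using pairs_le_card_lines[OF XH(1,3)] XH by simp
    then have "real (n * (n - 1)) \<le> real (min_lines n k * (k * (k - 1)))"
      by (simp only: of_nat_le_iff)
    then have "real n * (real n - 1) \<le> real (min_lines n k) * K"
      using assms n by (simp add: K_def of_nat_diff)
    then show ?thesis using n by (simp add: field_simps)
  qed
  have upper: "real (min_lines n k) * (K / (real n * (real n - 1))) \<le>
     (real n ^ 2 / K + D * real n * (log 2 (real n) + 1)) * (K / (real n * (real n - 1)))"
    if n: "n \<ge> 2" for n
  proof (rule mult_right_mono)
    obtain B where "linear_space k {..<n} B"
      "real (card B) \<le> real n ^ 2 / K + D * real n * (log 2 (real n) + 1)"
      using linear_space_few_blocks[OF assms, of n] n unfolding K_def D_def by auto
    then show "real (min_lines n k) \<le> real n ^ 2 / K + D * real n * (log 2 (real n) + 1)"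
      using min_lines_le_card_linear_space[of k n B] by linarith
    show "0 \<le> K / (real n * (real n - 1))" using K n by simp
  qed
  \<comment> \<open>In the leading term \<open>K\<close> cancels and leaves
    \<open>n / (n - 1)\<close>. The rest has order \<open>log n / n\<close> and vanishes.\<close>
  have lim: "(\<lambda>n. (real n ^ 2 / K + D * real n * (log 2 (real n) + 1)) *
      (K / (real n * (real n - 1)))) \<longlonglongrightarrow> 1"
    using K by real_asymp
  have "(\<lambda>n. real (min_lines n k) * (K / (real n * (real n - 1)))) \<longlonglongrightarrow> 1"
    by (rule real_tendsto_sandwich[OF eventually_sequentiallyI[OF lower]
          eventually_sequentiallyI[OF upper] tendsto_const lim])
  then show ?thesis unfolding K_def .
qed

end
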